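(* Let $0<q<1$ be fixed. Let $k,l$ be positive integers and $a,b,x$ be real numbers with $a,b,a+b\neq -1,-2,\ldots$ and $|x|<1$. Then \begin{align*} &(-1)^{k-1}\sum_{m=1}^\infty\frac{q^{(m+b)k}}{[m+b]^{k+l}}\sum_{j=1}^m\frac{x^{j+a+b}}{[j+a+b]} -(-1)^{l-1}\sum_{m=1}^\infty\frac{q^{(m+a)l}}{[m+a]^{k+l}}\sum_{j=1}^m\frac{x^{j+a+b}}{[j+a+b]}\\ & =\sum_{j=1}^{l-1}(-1)^{j-1}H_{k+j}[q^{j-1}x,a]H_{l+1-j}[x,b] -\sum_{j=1}^{k-1}(-1)^{j-1}H_{l+j}[q^{j-1}x,b]H_{k+1-j}[x,a]\\ &\quad +(-1)^{l-1}\left(H_1[x,b]H_{k+l}[q^{l-1}x,a]-H_1[x,a+b]H_{k+l}[q^l,a]\right)\\ &\quad -(-1)^{k-1}\left(H_1[x,a]H_{k+l}[q^{k-1}x,b]-H_1[x,a+b]H_{k+l}[q^k,b]\right). \end{align*}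
   Context: Fix $0<q<1$. For a real number $b$, $[b]=[b]_q:=\frac{1-q^b}{1-q}$. For a real number $a\neq-1,-2,\ldots$, a positive integer $k$ and $x\in(-1,1)$, $H_k[x,a]:=\sum_{m=1}^\infty \frac{x^{m+a}}{[m+a]^k}$. *)

theory Defs
  imports "HOL-Analysis.Analysis"
begin

definition qnum :: "real \<Rightarrow> real \<Rightarrow> real" where
  "qnum q b = (1 - q powr b) / (1 - q)"

(* The base x may be negative while the exponent c is not an integer, so the power is the
   principal-branch complex power exp (c * Ln x).  It is the usual real power for x > 0, and the
   usual integer power for x \<noteq> 0 and integral c.  For x = 0 it is 0 for every c. *)
definition rpow :: "real \<Rightarrow> real \<Rightarrow> complex" where
  "rpow x c = complex_of_real x powr complex_of_real c"

definition H :: "real \<Rightarrow> nat \<Rightarrow> real \<Rightarrow> real \<Rightarrow> complex" where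
  "H q k x a = (\<Sum>n. let m = real (Suc n) in
      rpow x (m + a) / complex_of_real (qnum q (m + a) ^ k))"

end

theory Submission
  imports Defs
begin

text \<open>Writing \<open>A = [m + a]\<close>, \<open>B = [n + b]\<close>, \<open>C = [m + n + a + b]\<close> and \<open>u = q\<^sup>m\<^sup>+\<^sup>a\<close>,
  \<open>v = q\<^sup>n\<^sup>+\<^sup>b\<close>, one has \<open>C = A + u B = B + v A\<close>.  Hence the double series of
  \<open>x\<^sup>m\<^sup>+\<^sup>n\<^sup>+\<^sup>a\<^sup>+\<^sup>b / (A\<^sup>k B\<^sup>l C)\<close> can be expanded in two ways: iterating
  \<open>1/(B C) = 1/(A B) - u/(A C)\<close> eliminates \<open>B\<close> next to \<open>C\<close>, and iterating
  \<open>1/(A C) = 1/(A B) - v/(B C)\<close> eliminates \<open>A\<close>.  Summing over \<open>n\<close> first in the former and over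
  \<open>m\<close> first in the latter and equating the results gives the theorem.\<close>

section \<open>Iterated sums\<close>

text \<open>Fubini for a double series dominated by a product. The majorant is summable over all
  pairs, so \<open>F\<close> has an unordered sum there, and both iterated sums compute it.\<close>

lemma double_series_sums_swap:
  fixes F :: "nat \<Rightarrow> nat \<Rightarrow> 'a::banach" and f g :: "nat \<Rightarrow> real"
  assumes f: "summable f" and g: "summable g"
    and le: "\<And>m n. norm (F m n) \<le> f m * g n"
    and f0: "\<And>m. f m \<ge> 0" and g0: "\<And>n. g n \<ge> 0"
  obtains S where "(\<lambda>m. \<Sum>n. F m n) sums S" and "(\<lambda>n. \<Sum>m. F m n) sums S"
proof -
  have "(\<lambda>(m, n). f m * g n) summable_on UNIV \<times> UNIV"
  proof -
    have gs: "g summable_on UNIV" and fs: "f summable_on UNIV"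
      using f g f0 g0 by (simp_all add: summable_on_UNIV_nonneg_real_iff)
    have "(\<lambda>p. norm (f (fst p) * g (snd p))) summable_on UNIV \<times> UNIV"
      unfolding Infinite_Sum.abs_summable_on_Sigma_iff
      using f0 g0 fs gs by (auto simp: abs_mult infsum_cmult_right' infsum_nonneg
          intro!: summable_on_cmult_right summable_on_cmult_left)
    then show ?thesis
      by (simp add: case_prod_unfold f0 g0)
  qed
  then have "(\<lambda>p. norm ((\<lambda>(m, n). F m n) p)) summable_on UNIV \<times> UNIV"
    by (rule Infinite_Sum.abs_summable_on_comparison_test') (use le in auto)
  then have "(\<lambda>(m, n). F m n) summable_on UNIV \<times> UNIV"
    by (rule abs_summable_summable)
  then obtain S where S: "((\<lambda>(m, n). F m n) has_sum S) (UNIV \<times> UNIV)"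
    by (auto simp: summable_on_def)
  have row: "((\<lambda>n. F m n) has_sum (\<Sum>n. F m n)) UNIV" for m
  proof -
    have "summable (\<lambda>n. norm (F m n))"
      by (rule summable_comparison_test'[OF summable_mult[OF g]]) (use le in auto)
    then show ?thesis
      by (simp add: norm_summable_imp_has_sum summable_norm_cancel summable_sums)
  qed
  have col: "((\<lambda>m. F m n) has_sum (\<Sum>m. F m n)) UNIV" for n
  proof -
    have "summable (\<lambda>m. norm (F m n))"
      by (rule summable_comparison_test'[OF summable_mult2[OF f]]) (use le in auto)
    then show ?thesis
      by (simp add: norm_summable_imp_has_sum summable_norm_cancel summable_sums)
  qed
  have S': "((\<lambda>(n, m). F m n) has_sum S) (UNIV \<times> UNIV)"
    using S by (subst has_sum_swap) (simp add: case_prod_unfold)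
  have "((\<lambda>m. \<Sum>n. F m n) has_sum S) UNIV"
    by (rule has_sum_SigmaD[OF S]) (use row in auto)
  moreover have "((\<lambda>n. \<Sum>m. F m n) has_sum S) UNIV"
    by (rule has_sum_SigmaD[OF S']) (use col in auto)
  ultimately show ?thesis
    using that has_sum_imp_sums by blast
qed

section \<open>Partial fractions\<close>

lemma partial_fraction_expansion:
  fixes A B C u :: "'a::field"
  assumes "C = A + u * B" "A \<noteq> 0" "B \<noteq> 0" "C \<noteq> 0"
  shows "1 / (A ^ k * B ^ l * C) =
    (\<Sum>i<l. (-1) ^ i * u ^ i / (A ^ (k + Suc i) * B ^ (l - i))) + (-1) ^ l * u ^ l / (A ^ (k + l) * C)"
proof (induction l)
  case 0
  then show ?case by simp
next
  case (Suc l)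
  \<comment> \<open>Over the common denominator \<open>A * B * C\<close> the right side has
    numerator \<open>C - u * B\<close>, which is \<open>A\<close>.\<close>
  have split: "1 / (B * C) = 1 / (A * B) - u / (A * C)"
    using assms(2-4) by (simp add: field_simps) (simp add: assms(1) algebra_simps)
  have "1 / (A ^ k * B ^ Suc l * C) = 1 / B * (1 / (A ^ k * B ^ l * C))"
    by simp
  also have "\<dots> = (\<Sum>i<l. 1 / B * ((-1) ^ i * u ^ i / (A ^ (k + Suc i) * B ^ (l - i))))
      + (-1) ^ l * u ^ l / A ^ (k + l) * (1 / (B * C))"
    by (simp add: Suc.IH distrib_left sum_distrib_left)
  also have "(\<Sum>i<l. 1 / B * ((-1) ^ i * u ^ i / (A ^ (k + Suc i) * B ^ (l - i)))) =
      (\<Sum>i<l. (-1) ^ i * u ^ i / (A ^ (k + Suc i) * B ^ (Suc l - i)))"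
    by (intro sum.cong refl) (simp add: Suc_diff_le)
  finally show ?case
    unfolding split by (simp add: algebra_simps diff_divide_distrib)
qed

section \<open>The series \<open>H\<close>\<close>

lemma qnum_nonzero:
  assumes "0 < q" "q < 1" "c \<noteq> 0"
  shows "qnum q c \<noteq> 0"
  using assms by (simp add: qnum_def powr_eq_one_iff_gen)

lemma qnum_add: "0 < q \<Longrightarrow> qnum q (c + d) = qnum q c + q powr c * qnum q d"
  by (simp add: qnum_def powr_add diff_divide_distrib algebra_simps)

lemma rpow_add: "rpow x (c + d) = rpow x c * rpow x d"
  by (simp add: rpow_def powr_add)

lemma norm_rpow: "norm (rpow x c) = \<bar>x\<bar> powr c"
  by (simp add: rpow_def norm_powr_real_powr')

lemma rpow_power: "0 < q \<Longrightarrow> rpow (q ^ i) c = complex_of_real (q powr c) ^ i"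
  by (simp add: rpow_def powr_of_real powr_powr mult.commute
      flip: powr_realpow of_real_power)

text \<open>The principal power splits here even for negative \<open>x\<close>, because the other
  factor \<open>q ^ i\<close> is positive. This turns powers of u from the partial fractions into a
  rescaled argument of \<open>H\<close>.\<close>

lemma rpow_power_mult:
  assumes "0 < q"
  shows "rpow (q ^ i * x) c = complex_of_real (q powr c) ^ i * rpow x c"
  using assms rpow_power[OF assms, of i c]
  by (simp add: rpow_def powr_times_real_left del: of_real_power)

text \<open>The reciprocals converge to \<open>1 - q\<close>, since
  \<open>q powr (real (Suc n) + a)\<close> tends to 0; a convergent sequence is bounded.\<close>

lemma qnum_inverse_bounded:
  assumes "0 < q" "q < 1" "\<And>n::nat. n \<ge> 1 \<Longrightarrow> a \<noteq> - real n"
  obtains M where "M > 0" "\<And>n. \<bar>1 / qnum q (real (Suc n) + a)\<bar> \<le> M"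
proof -
  have "(\<lambda>n. q ^ Suc n * q powr a) \<longlonglongrightarrow> 0 * q powr a"
    using assms by (intro tendsto_intros LIMSEQ_Suc LIMSEQ_realpow_zero) auto
  then have lim: "(\<lambda>n. q powr (real (Suc n) + a)) \<longlonglongrightarrow> 0"
    using assms(1) by (simp only: powr_add powr_realpow mult_zero_left)
  have "(\<lambda>n. 1 / qnum q (real (Suc n) + a)) \<longlonglongrightarrow> 1 / ((1 - 0) / (1 - q))"
    unfolding qnum_def using assms(2) by (intro tendsto_intros lim) auto
  then have "Bseq (\<lambda>n. 1 / qnum q (real (Suc n) + a))"
    by (intro convergent_imp_Bseq convergentI)
  then show ?thesis
    using that unfolding Bseq_def by auto
qed

definition H_term :: "real \<Rightarrow> nat \<Rightarrow> real \<Rightarrow> real \<Rightarrow> nat \<Rightarrow> complex" where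
  "H_term q k x a n =
    rpow x (real (Suc n) + a) / complex_of_real (qnum q (real (Suc n) + a) ^ k)"

text \<open>With the reciprocals of the q-numbers bounded by M, the terms are dominated by a
  geometric series of ratio \<open>\<bar>x\<bar>\<close>.\<close>

lemma summable_norm_H_term:
  assumes "0 < q" "q < 1" "\<And>n::nat. n \<ge> 1 \<Longrightarrow> a \<noteq> - real n" "\<bar>x\<bar> < 1"
  shows "summable (\<lambda>n. norm (H_term q k x a n))"
proof -
  obtain M where M: "M > 0" "\<And>n. \<bar>1 / qnum q (real (Suc n) + a)\<bar> \<le> M"
    using qnum_inverse_bounded[of q a] assms by blast
  have "summable (\<lambda>n. \<bar>x\<bar> ^ n * (\<bar>x\<bar> powr (1 + a) * M ^ k))"
    using assms(4) by (intro summable_mult2 summable_geometric) auto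
  then show ?thesis
  proof (rule summable_comparison_test')
    fix n
    have "norm (H_term q k x a n)
        = \<bar>x\<bar> powr (real (Suc n) + a) * \<bar>1 / qnum q (real (Suc n) + a)\<bar> ^ k"
      unfolding H_term_def norm_divide norm_rpow norm_of_real power_abs power_divide abs_divide
      by (simp del: of_nat_Suc)
    moreover have "\<bar>x\<bar> powr (real (Suc n) + a) = \<bar>x\<bar> ^ n * \<bar>x\<bar> powr (1 + a)"
      by (cases "x = 0") (simp_all add: powr_add powr_realpow)
    moreover have "\<bar>1 / qnum q (real (Suc n) + a)\<bar> ^ k \<le> M ^ k"
      by (intro power_mono M) auto
    ultimately show "norm (norm (H_term q k x a n)) \<le> \<bar>x\<bar> ^ n * (\<bar>x\<bar> powr (1 + a) * M ^ k)"
      by (simp add: mult.assoc mult_left_mono del: of_nat_Suc)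
  qed
qed

lemma H_term_sums:
  assumes "0 < q" "q < 1" "\<And>n::nat. n \<ge> 1 \<Longrightarrow> a \<noteq> - real n" "\<bar>x\<bar> < 1"
  shows "H_term q k x a sums H q k x a"
proof -
  have "H q k x a = suminf (H_term q k x a)"
    by (simp add: H_def H_term_def[abs_def] Let_def)
  then show ?thesis
    using summable_norm_cancel[OF summable_norm_H_term[OF assms]] by (simp add: summable_sums)
qed

section \<open>Expansion of the double series\<close>

definition double_term :: "real \<Rightarrow> nat \<Rightarrow> nat \<Rightarrow> real \<Rightarrow> real \<Rightarrow> real \<Rightarrow> nat \<Rightarrow> nat \<Rightarrow> complex" where
  "double_term q k l x a b m n = H_term q k x a m * H_term q l x b n /
    complex_of_real (qnum q (real (Suc m) + a + (real (Suc n) + b)))"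

text \<open>This symmetry makes the second expansion an instance of the first, with (k, a, m) and
  (l, b, n) exchanged.\<close>

lemma double_term_commute: "double_term q k l x a b m n = double_term q l k x b a n m"
  by (simp add: double_term_def add_ac mult_ac)

lemma double_term_sums_swap:
  assumes q: "0 < q" "q < 1"
    and a: "\<And>n::nat. n \<ge> 1 \<Longrightarrow> a \<noteq> - real n"
    and b: "\<And>n::nat. n \<ge> 1 \<Longrightarrow> b \<noteq> - real n"
    and ab: "\<And>n::nat. n \<ge> 1 \<Longrightarrow> a + b \<noteq> - real n"
    and x: "\<bar>x\<bar> < 1"
  obtains S where "(\<lambda>m. \<Sum>n. double_term q k l x a b m n) sums S"
    and "(\<lambda>n. \<Sum>m. double_term q k l x a b m n) sums S"
proof -
  \<comment> \<open>The coupling factor 1/C depends only on m + n, so a single bound M covers all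
    pairs and what remains is a product of a term in m and a term in n.\<close>
  obtain M where M: "M > 0" "\<And>n. \<bar>1 / qnum q (real (Suc n) + (a + b))\<bar> \<le> M"
    using qnum_inverse_bounded[of q "a + b"] q ab by blast
  show ?thesis
  proof (rule double_series_sums_swap[of "\<lambda>m. norm (H_term q k x a m)"
        "\<lambda>n. norm (H_term q l x b n) * M" "double_term q k l x a b"])
    show "norm (double_term q k l x a b m n)
        \<le> norm (H_term q k x a m) * (norm (H_term q l x b n) * M)" for m n
    proof -
      have "norm (double_term q k l x a b m n) = norm (H_term q k x a m) * (norm (H_term q l x b n) *
          \<bar>1 / qnum q (real (Suc (Suc (m + n))) + (a + b))\<bar>)"
        by (simp add: double_term_def norm_mult norm_divide add_ac)
      then show ?thesis
        unfolding mult.assoc[symmetric]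
        by (metis M(2) mult_left_mono mult_nonneg_nonneg norm_ge_zero)
    qed
  qed (use that M(1) summable_norm_H_term[OF q a x] summable_norm_H_term[OF q b x]
      in \<open>auto intro: summable_mult2\<close>)
qed

text \<open>The partial fractions are multiplied by \<open>X * Y\<close>. In the sum,
  \<open>u ^ i * X\<close> is the power with base \<open>q ^ i * x\<close>. In the remainder,
  \<open>u ^ l\<close> alone is the power with base \<open>q ^ l\<close>, while
  \<open>X * Y / C\<close> is a term of the series for \<open>H q 1 x (a + b)\<close>.\<close>

lemma double_term_expansion:
  assumes q: "0 < q" "q < 1"
    and a: "\<And>n::nat. n \<ge> 1 \<Longrightarrow> a \<noteq> - real n"
    and b: "\<And>n::nat. n \<ge> 1 \<Longrightarrow> b \<noteq> - real n"
    and ab: "\<And>n::nat. n \<ge> 1 \<Longrightarrow> a + b \<noteq> - real n"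
  shows "double_term q k l x a b m n =
    (\<Sum>i<l. (-1) ^ i * H_term q (k + Suc i) (q ^ i * x) a m * H_term q (l - i) x b n)
    + (-1) ^ l * H_term q (k + l) (q ^ l) a m * H_term q 1 x (a + b) (n + Suc m)"
proof -
  define A where "A = complex_of_real (qnum q (real (Suc m) + a))"
  define B where "B = complex_of_real (qnum q (real (Suc n) + b))"
  define C where "C = complex_of_real (qnum q (real (Suc m) + a + (real (Suc n) + b)))"
  define u where "u = complex_of_real (q powr (real (Suc m) + a))"
  define X where "X = rpow x (real (Suc m) + a)"
  define Y where "Y = rpow x (real (Suc n) + b)"
  \<comment> \<open>\<open>H_term\<close> at index N belongs to the summand number N + 1, so the
    summand number (m + 1) + (n + 1) has index \<open>n + Suc m\<close>.\<close>
  have shift: "real (Suc (n + Suc m)) + (a + b) = real (Suc m) + a + (real (Suc n) + b)"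
    by simp
  have "A \<noteq> 0" "B \<noteq> 0" "C \<noteq> 0"
    using qnum_nonzero[OF q] a[of "Suc m"] b[of "Suc n"] ab[of "Suc (n + Suc m)"]
    by (auto simp: A_def B_def C_def simp del: of_nat_Suc of_nat_add)
  moreover have "C = A + u * B"
    by (simp only: A_def B_def C_def u_def qnum_add[OF q(1)] of_real_add of_real_mult)
  ultimately have pf: "1 / (A ^ k * B ^ l * C) =
      (\<Sum>i<l. (-1) ^ i * u ^ i / (A ^ (k + Suc i) * B ^ (l - i)))
      + (-1) ^ l * u ^ l / (A ^ (k + l) * C)"
    by (intro partial_fraction_expansion)
  have "double_term q k l x a b m n = X * Y * (1 / (A ^ k * B ^ l * C))"
    by (simp add: double_term_def H_term_def A_def B_def C_def X_def Y_def)
  also have "\<dots> = (\<Sum>i<l. (-1) ^ i * (u ^ i * X / A ^ (k + Suc i)) * (Y / B ^ (l - i)))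
      + (-1) ^ l * (u ^ l / A ^ (k + l)) * (X * Y / C)"
    unfolding pf by (simp add: distrib_left sum_distrib_left mult_ac)
  finally show ?thesis
    unfolding H_term_def shift rpow_power_mult[OF q(1)] rpow_power[OF q(1)]
      rpow_add[of x "real (Suc m) + a"] power_one_right of_real_power
      A_def B_def C_def u_def X_def Y_def .
qed

text \<open>Summing the termwise expansion over n first yields products of \<open>H\<close> values,
  plus a remainder containing a tail of \<open>H q 1 x (a + b)\<close>. Writing that tail as the
  full series minus a partial sum produces the finite inner sum over j.\<close>

lemma double_series_expansion:
  assumes q: "0 < q" "q < 1" and l: "l \<ge> 1"
    and a: "\<And>n::nat. n \<ge> 1 \<Longrightarrow> a \<noteq> - real n"
    and b: "\<And>n::nat. n \<ge> 1 \<Longrightarrow> b \<noteq> - real n"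
    and ab: "\<And>n::nat. n \<ge> 1 \<Longrightarrow> a + b \<noteq> - real n"
    and x: "\<bar>x\<bar> < 1"
    and S: "(\<lambda>m. \<Sum>n. double_term q k l x a b m n) sums S"
  shows "S = (\<Sum>j=1..l-1. (-1) ^ (j - 1) * H q (k + j) (q ^ (j - 1) * x) a * H q (l + 1 - j) x b)
    + (-1) ^ (l - 1) *
         (H q 1 x b * H q (k + l) (q ^ (l - 1) * x) a - H q 1 x (a + b) * H q (k + l) (q ^ l) a)
    + (-1) ^ (l - 1) *
        (\<Sum>n. let m = Suc n in
           complex_of_real (q powr ((real m + a) * real l) / qnum q (real m + a) ^ (k + l)) *
           (\<Sum>j=1..m. rpow x (real j + a + b) / complex_of_real (qnum q (real j + a + b))))"
    (is "_ = ?J + _ + _ * (\<Sum>n. ?w n)")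
proof -
  define E where "E = (\<Sum>i<l. (-1) ^ i * H q (k + Suc i) (q ^ i * x) a * H q (l - i) x b)"
  define T where "T = H_term q (k + l) (q ^ l) a"
  define R where "R = H_term q 1 x (a + b)"
  have qi: "\<bar>q ^ i * x\<bar> < 1" for i
    using mult_left_le_one_le[of "\<bar>x\<bar>" "q ^ i"] q x power_le_one[of q i] by (simp add: abs_mult)
  \<comment> \<open>The argument \<open>q ^ l\<close> carries no factor \<open>x\<close>; that it
    lies below 1 comes from \<open>l \<ge> 1\<close>.\<close>
  have ql: "\<bar>q ^ l\<bar> < 1"
    using q l by (simp add: power_less_one_iff)
  have T: "T sums H q (k + l) (q ^ l) a"
    unfolding T_def by (rule H_term_sums[OF q a ql])
  have R: "R sums H q 1 x (a + b)"
    unfolding R_def by (rule H_term_sums[OF q ab x])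
  \<comment> \<open>For fixed m the index \<open>n + Suc m\<close> skips exactly the first m + 1
    terms of \<open>R\<close>.\<close>
  have inner: "(\<Sum>n. double_term q k l x a b m n) =
      (\<Sum>i<l. (-1) ^ i * H_term q (k + Suc i) (q ^ i * x) a m * H q (l - i) x b)
      + (-1) ^ l * T m * (H q 1 x (a + b) - (\<Sum>n<Suc m. R n))" for m
  proof (rule sums_unique[symmetric])
    show "double_term q k l x a b m sums
      ((\<Sum>i<l. (-1) ^ i * H_term q (k + Suc i) (q ^ i * x) a m * H q (l - i) x b)
      + (-1) ^ l * T m * (H q 1 x (a + b) - (\<Sum>n<Suc m. R n)))"
      by (rule iffD2[OF sums_cong], rule double_term_expansion[OF q a b ab], assumption+,
          fold T_def R_def)
        (intro sums_add sums_sum sums_mult sums_split_initial_segment H_term_sums q b x R)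
  qed
  have w: "?w m = T m * (\<Sum>n<Suc m. R n)" for m
  proof -
    have "(\<Sum>j=1..Suc m. rpow x (real j + a + b) / complex_of_real (qnum q (real j + a + b)))
        = (\<Sum>n<Suc m. R n)"
      unfolding R_def H_term_def One_nat_def sum.atLeast_Suc_atMost_Suc_shift
      by (simp add: atLeast0AtMost lessThan_Suc_atMost add_ac)
    moreover have "q powr ((real (Suc m) + a) * real l) = (q powr (real (Suc m) + a)) ^ l"
      by (simp only: powr_powr[symmetric]) (use q(1) in \<open>simp add: powr_realpow\<close>)
    then have "complex_of_real (q powr ((real (Suc m) + a) * real l)
          / qnum q (real (Suc m) + a) ^ (k + l)) = T m"
      using q(1) by (simp add: T_def H_term_def rpow_power del: of_nat_Suc)
    ultimately show ?thesis
      by (simp only: Let_def)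
  qed
  have "(\<lambda>m. \<Sum>i<l. (-1) ^ i * H_term q (k + Suc i) (q ^ i * x) a m * H q (l - i) x b) sums E"
    unfolding E_def by (intro sums_sum sums_mult sums_mult2 H_term_sums q a qi)
  \<comment> \<open>Removing the products of \<open>H\<close> values isolates the remainder series;
    multiplying by \<open>(-1) ^ l\<close> once more then cancels its sign.\<close>
  from sums_diff[OF S this]
  have "(\<lambda>m. (-1) ^ l * T m * (H q 1 x (a + b) - (\<Sum>n<Suc m. R n))) sums (S - E)"
    by (simp add: inner)
  from sums_mult[OF this, of "(-1) ^ l"]
  have "(\<lambda>m. T m * (H q 1 x (a + b) - (\<Sum>n<Suc m. R n))) sums ((-1) ^ l * (S - E))"
    by (simp add: mult.assoc flip: power_add mult_2)
  from sums_diff[OF sums_mult2[OF T, of "H q 1 x (a + b)"] this]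
  have "?w sums (H q (k + l) (q ^ l) a * H q 1 x (a + b) - (-1) ^ l * (S - E))"
    unfolding w by (simp add: algebra_simps)
  then have W: "(\<Sum>n. ?w n) = H q (k + l) (q ^ l) a * H q 1 x (a + b) - (-1) ^ l * (S - E)"
    by (rule sums_unique[symmetric])
  obtain l' where l': "l = Suc l'"
    using l by (cases l) auto
  \<comment> \<open>With j = i + 1, the summands i < l - 1 form \<open>?J\<close>; the last one, i =
    l - 1, contains \<open>H q 1 x b\<close> and is split off.\<close>
  have "E = ?J + (-1) ^ (l - 1) * (H q 1 x b * H q (k + l) (q ^ (l - 1) * x) a)"
    unfolding E_def l'
    by (auto simp: sum.atLeast1_atMost_eq mult_ac Suc_diff_le Suc_diff_Suc intro!: sum.cong)
  moreover have "S - E = (-1) ^ l * (H q (k + l) (q ^ l) a * H q 1 x (a + b) - (\<Sum>n. ?w n))"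
    unfolding W by (simp flip: mult.assoc power_add mult_2)
  moreover have "(-1) ^ l = - ((-1) ^ (l - 1) :: complex)"
    by (simp add: l')
  \<comment> \<open>The final rearrangement is stated for opaque variables, so that the series and
    signs are not rewritten by the algebra.\<close>
  moreover have "S = ?J + p * X - p * Y + p * Z"
    if "E = ?J + p * X" "S - E = r * (Y - Z)" "r = - p" for p r X Y Z
    using that by (simp add: algebra_simps)
  ultimately show ?thesis
    by (simp only: right_diff_distrib mult.commute[of "H q 1 x (a + b)"] add_diff_eq)
qed

theorem theorem1p1:
  fixes q a b x :: real and k l :: nat
  assumes "0 < q" and "q < 1"
    and "k \<ge> 1" and "l \<ge> 1"
    and "\<And>n::nat. n \<ge> 1 \<Longrightarrow> a \<noteq> - real n"
    and "\<And>n::nat. n \<ge> 1 \<Longrightarrow> b \<noteq> - real n"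
    and "\<And>n::nat. n \<ge> 1 \<Longrightarrow> a + b \<noteq> - real n"
    and "\<bar>x\<bar> < 1"
  shows
    "(-1) ^ (k - 1) *
        (\<Sum>n. let m = Suc n in
           complex_of_real (q powr ((real m + b) * real k) / qnum q (real m + b) ^ (k + l)) *
           (\<Sum>j=1..m. rpow x (real j + a + b) / complex_of_real (qnum q (real j + a + b))))
     - (-1) ^ (l - 1) *
        (\<Sum>n. let m = Suc n in
           complex_of_real (q powr ((real m + a) * real l) / qnum q (real m + a) ^ (k + l)) *
           (\<Sum>j=1..m. rpow x (real j + a + b) / complex_of_real (qnum q (real j + a + b))))
     = (\<Sum>j=1..l-1. (-1) ^ (j - 1) * H q (k + j) (q ^ (j - 1) * x) a * H q (l + 1 - j) x b)
     - (\<Sum>j=1..k-1. (-1) ^ (j - 1) * H q (l + j) (q ^ (j - 1) * x) b * H q (k + 1 - j) x a)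
     + (-1) ^ (l - 1) *
         (H q 1 x b * H q (k + l) (q ^ (l - 1) * x) a - H q 1 x (a + b) * H q (k + l) (q ^ l) a)
     - (-1) ^ (k - 1) *
         (H q 1 x a * H q (k + l) (q ^ (k - 1) * x) b - H q 1 x (a + b) * H q (k + l) (q ^ k) b)"
proof -
  obtain S where S1: "(\<lambda>m. \<Sum>n. double_term q k l x a b m n) sums S"
    and "(\<lambda>n. \<Sum>m. double_term q k l x a b m n) sums S"
    using double_term_sums_swap[of q a b x k l] assms by blast
  \<comment> \<open>The sum over m first, read with the roles exchanged, has the form required for
    expanding in the other direction.\<close>
  then have S2: "(\<lambda>n. \<Sum>m. double_term q l k x b a n m) sums S"
    by (simp add: double_term_commute[of q k l x a b])
  have ba: "b + a \<noteq> - real n" if "n \<ge> 1" for n :: nat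
    using assms(7)[OF that] by (simp add: add.commute)
  have comm: "real j + b + a = real j + a + b" "b + a = a + b" "l + k = k + l" for j :: nat
    by simp_all
  note ea = double_series_expansion[OF assms(1,2,4,5,6,7,8) S1]
  note eb = double_series_expansion[OF assms(1,2,3,6,5) ba assms(8) S2, unfolded comm]
  show ?thesis
    \<comment> \<open>Both expansions equal the same \<open>S\<close>; moving the weighted series to
      one side gives the identity.\<close>
    using trans[OF ea[symmetric] eb] by (simp only: algebra_simps)
qed

end
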